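(* Let $\mathbf{C}$ be a category with pullbacks and with an $\mathcal{M}$-partial map classifier $(T,\eta)$ for a stable system of monos $\mathcal{M}$. Then for every mono $m:L\rightarrowtail G$ in $\mathcal{M}$, the functor $\mathrm{fpbc}_m=\mathrm{pb}_{\overline{m}}\circ T:\mathbf{C}\downarrow L\to\mathbf{C}\downarrow G$ is right adjoint to the pullback functor $\mathrm{pb}_m:\mathbf{C}\downarrow G\to\mathbf{C}\downarrow L$, and the counit of this adjunction is a natural isomorphism.
   Context: A stable system of monos $\mathcal{M}$ is a class of monos containing all isomorphisms, closed under composition, and stable under pullback. An $\mathcal{M}$-partial map classifier is a functor $T:\mathbf{C}\to\mathbf{C}$ with a natural transformation $\eta:\mathrm{Id}\Rightarrow T$ such that for every span $Z\xleftarrow{m}X\xrightarrow{f}Y$ with $m\in\mathcal{M}$ there is a unique arrow $\varphi(m,f):Z\to T(Y)$ making the square $\varphi(m,f)\circ m=\eta_Y\circ f$ a pullback. For $m:X\rightarrowtail Z$ in $\mathcal{M}$ write $\overline{m}=\varphi(m,\mathrm{id}_X):Z\to T(X)$. $\mathbf{C}\downarrow X$ denotes the slice category over $X$. For an arrow $m:X\to Z$, the pullback functor $\mathrm{pb}_m:\mathbf{C}\downarrow Z\to\mathbf{C}\downarrow X$ sends $h:W\to Z$ to the arrow $f:Y\to X$ obtained by pulling back $h$ along $m$, and acts on arrows via the universal property (defined up to isomorphism). The endofunctor $T$ induces $T:\mathbf{C}\downarrow L\to\mathbf{C}\downarrow T(L)$, $(f:Y\to L)\mapsto (T(f):T(Y)\to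 T(L))$; composing with $\mathrm{pb}_{\overline{m}}:\mathbf{C}\downarrow T(L)\to\mathbf{C}\downarrow G$, where $\overline{m}:G\to T(L)$, gives $\mathrm{fpbc}_m$.
   Formalization: The partial map classifier is also required to have cartesian η (its naturality squares are pullbacks), as standard classifiers do; without this the claim fails, e.g. in Set with M the isomorphisms, T the covariant powerset and η the singleton maps. *)

theory Defs
  imports Main
begin

section \<open>Categories, functors, natural transformations, adjunctions\<close>

record ('o, 'a) precategory =
  obj :: "'o set"
  arr :: "'a set"
  src :: "'a \<Rightarrow> 'o"
  tgt :: "'a \<Rightarrow> 'o"
  ide :: "'o \<Rightarrow> 'a"
  cmp :: "'a \<Rightarrow> 'a \<Rightarrow> 'a"  (infixl "\<cdot>\<index>" 70)

definition hom :: "('o, 'a, 'z) precategory_scheme \<Rightarrow> 'o \<Rightarrow> 'o \<Rightarrow> 'a set" where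
  "hom C x y = {f \<in> arr C. src C f = x \<and> tgt C f = y}"

text \<open>\<open>g \<cdot>\<^bsub>C\<^esub> f\<close> is \<open>g\<close> after \<open>f\<close>; its value is irrelevant when \<open>tgt C f \<noteq> src C g\<close>.\<close>

definition is_category :: "('o, 'a, 'z) precategory_scheme \<Rightarrow> bool" where
  "is_category C \<longleftrightarrow>
     (\<forall>f \<in> arr C. src C f \<in> obj C \<and> tgt C f \<in> obj C) \<and>
     (\<forall>x \<in> obj C. ide C x \<in> hom C x x) \<and>
     (\<forall>f \<in> arr C. \<forall>g \<in> arr C. tgt C f = src C g \<longrightarrow>
        g \<cdot>\<^bsub>C\<^esub> f \<in> hom C (src C f) (tgt C g)) \<and>
     (\<forall>f \<in> arr C. f \<cdot>\<^bsub>C\<^esub> ide C (src C f) = f \<and> ide C (tgt C f) \<cdot>\<^bsub>C\<^esub> f = f) \<and>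
     (\<forall>f \<in> arr C. \<forall>g \<in> arr C. \<forall>h \<in> arr C. tgt C f = src C g \<longrightarrow> tgt C g = src C h \<longrightarrow>
        (h \<cdot>\<^bsub>C\<^esub> g) \<cdot>\<^bsub>C\<^esub> f = h \<cdot>\<^bsub>C\<^esub> (g \<cdot>\<^bsub>C\<^esub> f))"

definition is_mono :: "('o, 'a, 'z) precategory_scheme \<Rightarrow> 'a \<Rightarrow> bool" where
  "is_mono C m \<longleftrightarrow> m \<in> arr C \<and>
     (\<forall>f \<in> arr C. \<forall>g \<in> arr C. src C f = src C g \<longrightarrow> tgt C f = src C m \<longrightarrow> tgt C g = src C m \<longrightarrow>
        m \<cdot>\<^bsub>C\<^esub> f = m \<cdot>\<^bsub>C\<^esub> g \<longrightarrow> f = g)"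

definition is_iso :: "('o, 'a, 'z) precategory_scheme \<Rightarrow> 'a \<Rightarrow> bool" where
  "is_iso C f \<longleftrightarrow> f \<in> arr C \<and>
     (\<exists>g \<in> hom C (tgt C f) (src C f).
        g \<cdot>\<^bsub>C\<^esub> f = ide C (src C f) \<and> f \<cdot>\<^bsub>C\<^esub> g = ide C (tgt C f))"

record ('o, 'a, 'p, 'b) prefunctor =
  omap :: "'o \<Rightarrow> 'p"
  amap :: "'a \<Rightarrow> 'b"

definition is_functor ::
  "('o, 'a) precategory \<Rightarrow> ('p, 'b) precategory \<Rightarrow> ('o, 'a, 'p, 'b) prefunctor \<Rightarrow> bool" where
  "is_functor C D F \<longleftrightarrow>
     is_category C \<and> is_category D \<and>
     (\<forall>x \<in> obj C. omap F x \<in> obj D \<and> amap F (ide C x) = ide D (omap F x)) \<and>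
     (\<forall>f \<in> arr C. amap F f \<in> hom D (omap F (src C f)) (omap F (tgt C f))) \<and>
     (\<forall>f \<in> arr C. \<forall>g \<in> arr C. tgt C f = src C g \<longrightarrow>
        amap F (g \<cdot>\<^bsub>C\<^esub> f) = amap F g \<cdot>\<^bsub>D\<^esub> amap F f)"

definition id_functor :: "('o, 'a, 'o, 'a) prefunctor" where
  "id_functor = \<lparr>omap = (\<lambda>x. x), amap = (\<lambda>f. f)\<rparr>"

definition comp_functor ::
  "('p, 'b, 'q, 'c) prefunctor \<Rightarrow> ('o, 'a, 'p, 'b) prefunctor \<Rightarrow> ('o, 'a, 'q, 'c) prefunctor"
  (infixl "\<circ>\<^sub>F" 55) where
  "G \<circ>\<^sub>F F = \<lparr>omap = omap G \<circ> omap F, amap = amap G \<circ> amap F\<rparr>"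

definition natural_transformation ::
  "('o, 'a) precategory \<Rightarrow> ('p, 'b) precategory \<Rightarrow> ('o, 'a, 'p, 'b) prefunctor \<Rightarrow>
   ('o, 'a, 'p, 'b) prefunctor \<Rightarrow> ('o \<Rightarrow> 'b) \<Rightarrow> bool" where
  "natural_transformation C D F G \<tau> \<longleftrightarrow>
     is_functor C D F \<and> is_functor C D G \<and>
     (\<forall>x \<in> obj C. \<tau> x \<in> hom D (omap F x) (omap G x)) \<and>
     (\<forall>f \<in> arr C. amap G f \<cdot>\<^bsub>D\<^esub> \<tau> (src C f) = \<tau> (tgt C f) \<cdot>\<^bsub>D\<^esub> amap F f)"

definition natural_isomorphism ::
  "('o, 'a) precategory \<Rightarrow> ('p, 'b) precategory \<Rightarrow> ('o, 'a, 'p, 'b) prefunctor \<Rightarrow>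
   ('o, 'a, 'p, 'b) prefunctor \<Rightarrow> ('o \<Rightarrow> 'b) \<Rightarrow> bool" where
  "natural_isomorphism C D F G \<tau> \<longleftrightarrow>
     natural_transformation C D F G \<tau> \<and> (\<forall>x \<in> obj C. is_iso D (\<tau> x))"

text \<open>\<open>F : C \<rightarrow> D\<close> is left adjoint to \<open>G : D \<rightarrow> C\<close>, with unit \<open>u\<close> and counit \<open>e\<close>.\<close>

definition adjunction ::
  "('o, 'a) precategory \<Rightarrow> ('p, 'b) precategory \<Rightarrow> ('o, 'a, 'p, 'b) prefunctor \<Rightarrow>
   ('p, 'b, 'o, 'a) prefunctor \<Rightarrow> ('o \<Rightarrow> 'a) \<Rightarrow> ('p \<Rightarrow> 'b) \<Rightarrow> bool" where
  "adjunction C D F G u e \<longleftrightarrow>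
     is_functor C D F \<and> is_functor D C G \<and>
     natural_transformation C C id_functor (G \<circ>\<^sub>F F) u \<and>
     natural_transformation D D (F \<circ>\<^sub>F G) id_functor e \<and>
     (\<forall>x \<in> obj C. e (omap F x) \<cdot>\<^bsub>D\<^esub> amap F (u x) = ide D (omap F x)) \<and>
     (\<forall>y \<in> obj D. amap G (e y) \<cdot>\<^bsub>C\<^esub> u (omap G y) = ide C (omap G y))"


section \<open>Pullbacks and slices\<close>

text \<open>The square \<open>f \<cdot> p = g \<cdot> q\<close> is a pullback: \<open>p\<close> is the pullback of \<open>g\<close> along \<open>f\<close>.\<close>

definition is_pullback ::
  "('o, 'a) precategory \<Rightarrow> 'a \<Rightarrow> 'a \<Rightarrow> 'a \<Rightarrow> 'a \<Rightarrow> bool" where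
  "is_pullback C p q f g \<longleftrightarrow>
     f \<in> arr C \<and> g \<in> arr C \<and> tgt C f = tgt C g \<and>
     p \<in> arr C \<and> q \<in> arr C \<and> src C p = src C q \<and> tgt C p = src C f \<and> tgt C q = src C g \<and>
     f \<cdot>\<^bsub>C\<^esub> p = g \<cdot>\<^bsub>C\<^esub> q \<and>
     (\<forall>x \<in> arr C. \<forall>y \<in> arr C.
        src C x = src C y \<longrightarrow> tgt C x = src C f \<longrightarrow> tgt C y = src C g \<longrightarrow>
        f \<cdot>\<^bsub>C\<^esub> x = g \<cdot>\<^bsub>C\<^esub> y \<longrightarrow>
        (\<exists>!v. v \<in> hom C (src C x) (src C p) \<and> p \<cdot>\<^bsub>C\<^esub> v = x \<and> q \<cdot>\<^bsub>C\<^esub> v = y))"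

definition has_pullbacks :: "('o, 'a) precategory \<Rightarrow> bool" where
  "has_pullbacks C \<longleftrightarrow>
     (\<forall>f \<in> arr C. \<forall>g \<in> arr C. tgt C f = tgt C g \<longrightarrow> (\<exists>p q. is_pullback C p q f g))"

text \<open>Pullback functors depend on a choice of pullbacks: \<open>\<chi> f g\<close> is the chosen pair of
  projections for the cospan \<open>(f, g)\<close>.\<close>

definition pullback_choice ::
  "('o, 'a) precategory \<Rightarrow> ('a \<Rightarrow> 'a \<Rightarrow> 'a \<times> 'a) \<Rightarrow> bool" where
  "pullback_choice C \<chi> \<longleftrightarrow>
     (\<forall>f \<in> arr C. \<forall>g \<in> arr C. tgt C f = tgt C g \<longrightarrow>
        is_pullback C (fst (\<chi> f g)) (snd (\<chi> f g)) f g)"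

text \<open>An arrow of the slice from \<open>f\<close> to \<open>g\<close> is the triple \<open>(f, k, g)\<close> where \<open>g \<cdot> k = f\<close>; the
  endpoints are recorded because \<open>k\<close> does not determine them.\<close>

definition slice :: "('o, 'a) precategory \<Rightarrow> 'o \<Rightarrow> ('a, 'a \<times> 'a \<times> 'a) precategory" where
  "slice C X =
     \<lparr>obj = {f \<in> arr C. tgt C f = X},
      arr = {(f, k, g). f \<in> arr C \<and> g \<in> arr C \<and> tgt C f = X \<and> tgt C g = X \<and>
                        k \<in> hom C (src C f) (src C g) \<and> g \<cdot>\<^bsub>C\<^esub> k = f},
      src = (\<lambda>(f, k, g). f),
      tgt = (\<lambda>(f, k, g). g),
      ide = (\<lambda>f. (f, ide C (src C f), f)),
      cmp = (\<lambda>(f', k', g') (f, k, g). (f, k' \<cdot>\<^bsub>C\<^esub> k, g'))\<rparr>"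

definition pb ::
  "('o, 'a) precategory \<Rightarrow> ('a \<Rightarrow> 'a \<Rightarrow> 'a \<times> 'a) \<Rightarrow> 'a \<Rightarrow>
   ('a, 'a \<times> 'a \<times> 'a, 'a, 'a \<times> 'a \<times> 'a) prefunctor" where
  "pb C \<chi> m =
     \<lparr>omap = (\<lambda>h. fst (\<chi> m h)),
      amap = (\<lambda>(h, k, h').
        (fst (\<chi> m h),
         (THE v. v \<in> hom C (src C (fst (\<chi> m h))) (src C (fst (\<chi> m h'))) \<and>
                 fst (\<chi> m h') \<cdot>\<^bsub>C\<^esub> v = fst (\<chi> m h) \<and>
                 snd (\<chi> m h') \<cdot>\<^bsub>C\<^esub> v = k \<cdot>\<^bsub>C\<^esub> snd (\<chi> m h)),
         fst (\<chi> m h')))\<rparr>"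

text \<open>The functor between slices induced by \<open>T\<close>; it has type \<open>C\<down>L \<rightarrow> C\<down>T(L)\<close> for every \<open>L\<close>.\<close>

definition slice_map ::
  "('o, 'a, 'o, 'a) prefunctor \<Rightarrow> ('a, 'a \<times> 'a \<times> 'a, 'a, 'a \<times> 'a \<times> 'a) prefunctor" where
  "slice_map T =
     \<lparr>omap = amap T, amap = (\<lambda>(f, k, g). (amap T f, amap T k, amap T g))\<rparr>"


section \<open>Partial map classifiers\<close>

definition stable_system_of_monos :: "('o, 'a) precategory \<Rightarrow> 'a set \<Rightarrow> bool" where
  "stable_system_of_monos C M \<longleftrightarrow>
     (\<forall>m \<in> M. is_mono C m) \<and>
     (\<forall>f. is_iso C f \<longrightarrow> f \<in> M) \<and>
     (\<forall>m \<in> M. \<forall>n \<in> M. tgt C m = src C n \<longrightarrow> n \<cdot>\<^bsub>C\<^esub> m \<in> M) \<and>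
     (\<forall>m \<in> M. \<forall>f p q. is_pullback C p q f m \<longrightarrow> p \<in> M)"

definition classifies ::
  "('o, 'a) precategory \<Rightarrow> ('o, 'a, 'o, 'a) prefunctor \<Rightarrow> ('o \<Rightarrow> 'a) \<Rightarrow> 'a \<Rightarrow> 'a \<Rightarrow> 'a \<Rightarrow> bool" where
  "classifies C T \<eta> m f k \<longleftrightarrow>
     k \<in> hom C (tgt C m) (omap T (tgt C f)) \<and> is_pullback C m f k (\<eta> (tgt C f))"

text \<open>The last conjunct says that \<open>\<eta>\<close> is cartesian.  For the usual partial map classifiers, where
  \<open>\<eta>\<^sub>X\<close> lies in \<open>M\<close> and \<open>T\<close> acts on arrows by \<open>T(f) = \<phi>(\<eta>\<^sub>X, f)\<close>, it holds by the definition of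
  \<open>\<phi>\<close>.  It has to be stated, because the universal property alone constrains neither \<open>\<eta>\<^sub>X \<in> M\<close>
  nor the action of \<open>T\<close> on arrows: if \<open>M\<close> consists of the isomorphisms only, then every
  endofunctor with a monic \<open>\<eta>\<close> has that property, for example the covariant powerset functor on
  sets with the singleton maps.\<close>

definition partial_map_classifier ::
  "('o, 'a) precategory \<Rightarrow> 'a set \<Rightarrow> ('o, 'a, 'o, 'a) prefunctor \<Rightarrow> ('o \<Rightarrow> 'a) \<Rightarrow> bool" where
  "partial_map_classifier C M T \<eta> \<longleftrightarrow>
     is_functor C C T \<and>
     natural_transformation C C id_functor T \<eta> \<and>
     (\<forall>m \<in> M. \<forall>f \<in> arr C. src C m = src C f \<longrightarrow> (\<exists>!k. classifies C T \<eta> m f k)) \<and>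
     (\<forall>f \<in> arr C. is_pullback C (\<eta> (src C f)) f (amap T f) (\<eta> (tgt C f)))"

definition classifying_arrow ::
  "('o, 'a) precategory \<Rightarrow> ('o, 'a, 'o, 'a) prefunctor \<Rightarrow> ('o \<Rightarrow> 'a) \<Rightarrow> 'a \<Rightarrow> 'a \<Rightarrow> 'a" where
  "classifying_arrow C T \<eta> m f = (THE k. classifies C T \<eta> m f k)"

definition classifying_bar ::
  "('o, 'a) precategory \<Rightarrow> ('o, 'a, 'o, 'a) prefunctor \<Rightarrow> ('o \<Rightarrow> 'a) \<Rightarrow> 'a \<Rightarrow> 'a" where
  "classifying_bar C T \<eta> m = classifying_arrow C T \<eta> m (ide C (src C m))"

definition fpbc ::
  "('o, 'a) precategory \<Rightarrow> ('a \<Rightarrow> 'a \<Rightarrow> 'a \<times> 'a) \<Rightarrow> ('o, 'a, 'o, 'a) prefunctor \<Rightarrow> ('o \<Rightarrow> 'a) \<Rightarrow> 'a \<Rightarrow>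
   ('a, 'a \<times> 'a \<times> 'a, 'a, 'a \<times> 'a \<times> 'a) prefunctor" where
  "fpbc C \<chi> T \<eta> m = pb C \<chi> (classifying_bar C T \<eta> m) \<circ>\<^sub>F slice_map T"

end

theory Submission
  imports Defs
begin

text \<open>For \<open>h : W \<rightarrow> G\<close> let \<open>h' : V \<rightarrow> L\<close> and \<open>n : V \<rightarrow> W\<close> be its pullback along \<open>m\<close>; by stability \<open>n \<in> M\<close>.
  An arrow from \<open>h\<close> to the pullback of \<open>T f\<close> along the classifying arrow \<open>b\<close> of \<open>m\<close> amounts to
  some \<open>w : W \<rightarrow> T Y\<close> with \<open>T f \<cdot> w = b \<cdot> h\<close>.  Pasting the pullback defining \<open>h'\<close> with the one
  defining \<open>b\<close> shows that \<open>b \<cdot> h\<close> classifies \<open>(n, h')\<close>.  As \<open>\<eta>\<close> is cartesian, pasting and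
  cancelling with the naturality square of \<open>f\<close> shows that those \<open>w\<close> are exactly the arrows
  classifying \<open>(n, k)\<close> with \<open>f \<cdot> k = h'\<close>, so they correspond bijectively to the arrows \<open>k : h' \<rightarrow> f\<close>
  over \<open>L\<close>.  The counit at \<open>f\<close> compares two pullbacks of \<open>T f\<close> along \<open>b \<cdot> m = \<eta>\<^sub>L\<close>.\<close>

section \<open>Elementary category calculus phrased with hom-sets\<close>

lemma homD:
  assumes "f \<in> hom C x y"
  shows "f \<in> arr C" "src C f = x" "tgt C f = y"
  using assms by (auto simp: hom_def)

locale cat =
  fixes C :: "('o, 'a) precategory" (structure)
  assumes is_cat: "is_category C"
begin

lemma obj_of_hom:
  assumes "f \<in> hom C x y"
  shows "x \<in> obj C" "y \<in> obj C"
  using is_cat assms by (auto simp: is_category_def hom_def)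

lemma ide_hom: "x \<in> obj C \<Longrightarrow> ide C x \<in> hom C x x"
  using is_cat by (simp add: is_category_def)

lemma comp_hom: "f \<in> hom C x y \<Longrightarrow> g \<in> hom C y z \<Longrightarrow> g \<cdot> f \<in> hom C x z"
  using is_cat by (auto simp: is_category_def hom_def)

lemma comp_ide: "f \<in> hom C x y \<Longrightarrow> f \<cdot> ide C x = f"
  using is_cat by (auto simp: is_category_def hom_def)

lemma ide_comp: "f \<in> hom C x y \<Longrightarrow> ide C y \<cdot> f = f"
  using is_cat by (auto simp: is_category_def hom_def)

lemma comp_assoc:
  "f \<in> hom C w x \<Longrightarrow> g \<in> hom C x y \<Longrightarrow> h \<in> hom C y z \<Longrightarrow> (h \<cdot> g) \<cdot> f = h \<cdot> (g \<cdot> f)"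
  using is_cat by (auto simp: is_category_def hom_def)

lemma is_isoI:
  "f \<in> hom C x y \<Longrightarrow> g \<in> hom C y x \<Longrightarrow> g \<cdot> f = ide C x \<Longrightarrow> f \<cdot> g = ide C y \<Longrightarrow> is_iso C f"
  by (auto simp: is_iso_def hom_def)

lemma is_isoE:
  assumes "is_iso C f" "f \<in> hom C x y"
  obtains g where "g \<in> hom C y x" "g \<cdot> f = ide C x" "f \<cdot> g = ide C y"
  using assms by (auto simp: is_iso_def hom_def)

section \<open>Pullback squares: mediating arrows, pasting, cancellation, comparison\<close>

lemma pullbackE:
  assumes "is_pullback C p q f g"
  obtains a b c d where "f \<in> hom C a c" "g \<in> hom C b c" "p \<in> hom C d a" "q \<in> hom C d b"
  using assms that[of "src C f" "tgt C f" "src C g" "src C p"]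
  by (auto simp: is_pullback_def hom_def)

lemma pullback_commutes: "is_pullback C p q f g \<Longrightarrow> f \<cdot> p = g \<cdot> q"
  by (simp add: is_pullback_def)

lemma pullback_ex1:
  assumes "is_pullback C p q f g" "p \<in> hom C d a" "q \<in> hom C d b"
    "x \<in> hom C t a" "y \<in> hom C t b" "f \<cdot> x = g \<cdot> y"
  shows "\<exists>!v. v \<in> hom C t d \<and> p \<cdot> v = x \<and> q \<cdot> v = y"
proof -
  have "x \<in> arr C" "y \<in> arr C" "src C x = src C y" "tgt C x = src C f" "tgt C y = src C g"
    and eqs: "src C x = t" "src C p = d"
    using assms by (auto simp: is_pullback_def hom_def)
  then have "\<exists>!v. v \<in> hom C (src C x) (src C p) \<and> p \<cdot> v = x \<and> q \<cdot> v = y"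
    using assms(1,6) unfolding is_pullback_def by blast
  then show ?thesis unfolding eqs .
qed

lemma pullback_lift:
  assumes "is_pullback C p q f g" "p \<in> hom C d a" "q \<in> hom C d b"
    "x \<in> hom C t a" "y \<in> hom C t b" "f \<cdot> x = g \<cdot> y"
  obtains v where "v \<in> hom C t d" "p \<cdot> v = x" "q \<cdot> v = y"
  using pullback_ex1[OF assms] by blast

text \<open>Both arrows mediate the same cone, which commutes because the square does, so uniqueness
  of mediating arrows identifies them.\<close>

lemma pullback_jointly_monic:
  assumes pb: "is_pullback C p q f g" and p: "p \<in> hom C d a"
    and v: "v \<in> hom C t d" and w: "w \<in> hom C t d"
    and eq: "p \<cdot> v = p \<cdot> w" "q \<cdot> v = q \<cdot> w"
  shows "v = w"
proof -
  obtain a' b c d' where h: "f \<in> hom C a' c" "g \<in> hom C b c" "p \<in> hom C d' a'" "q \<in> hom C d' b"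
    using pullbackE[OF pb] .
  with p have [simp]: "d' = d" "a' = a" by (auto simp: hom_def)
  note h = h[simplified]
  have "f \<cdot> (p \<cdot> v) = g \<cdot> (q \<cdot> v)"
    using comp_assoc[OF v h(3) h(1)] comp_assoc[OF v h(4) h(2)] pullback_commutes[OF pb] by simp
  from pullback_ex1[OF pb h(3,4) comp_hom[OF v h(3)] comp_hom[OF v h(4)] this]
  show ?thesis using v w eq by auto
qed

text \<open>Separates unique existence into existence of a mediating arrow and joint monicity of the
  projections, which are then checked by different means.\<close>

lemma is_pullbackI:
  assumes f: "f \<in> hom C a c" and g: "g \<in> hom C b c" and p: "p \<in> hom C d a" and q: "q \<in> hom C d b"
    and "f \<cdot> p = g \<cdot> q"
    and ex: "\<And>t x y. x \<in> hom C t a \<Longrightarrow> y \<in> hom C t b \<Longrightarrow> f \<cdot> x = g \<cdot> y \<Longrightarrow>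
      \<exists>v \<in> hom C t d. p \<cdot> v = x \<and> q \<cdot> v = y"
    and uniq: "\<And>t v w. v \<in> hom C t d \<Longrightarrow> w \<in> hom C t d \<Longrightarrow> p \<cdot> v = p \<cdot> w \<Longrightarrow> q \<cdot> v = q \<cdot> w \<Longrightarrow> v = w"
  shows "is_pullback C p q f g"
  unfolding is_pullback_def
proof (intro conjI ballI impI)
  fix x y
  assume xy: "x \<in> arr C" "y \<in> arr C" "src C x = src C y" "tgt C x = src C f" "tgt C y = src C g"
    "f \<cdot> x = g \<cdot> y"
  have "x \<in> hom C (src C x) a" "y \<in> hom C (src C x) b" using xy f g by (auto simp: hom_def)
  from ex[OF this xy(6)] uniq
  have "\<exists>!v. v \<in> hom C (src C x) d \<and> p \<cdot> v = x \<and> q \<cdot> v = y" by (metis (no_types))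
  then show "\<exists>!v. v \<in> hom C (src C x) (src C p) \<and> p \<cdot> v = x \<and> q \<cdot> v = y"
    using homD(2)[OF p] by simp
qed (use assms(1-5) in \<open>auto simp: hom_def\<close>)

lemma pullback_swap:
  assumes "is_pullback C p q f g"
  shows "is_pullback C q p g f"
  using assms unfolding is_pullback_def by (metis (no_types, lifting))

text \<open>The squares share the edge \<open>e\<close>: \<open>w \<cdot> n = e \<cdot> k\<close>
  stands next to \<open>t \<cdot> e = e' \<cdot> f\<close>. A cone over the outer cospan is lifted
  through the square on \<open>t\<close> first, and the result through the square on
  \<open>w\<close>.\<close>

lemma pullback_paste:
  assumes l: "is_pullback C n k w e" and r: "is_pullback C e f t e'"
  shows "is_pullback C n (f \<cdot> k) (t \<cdot> w) e'"
proof -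
  obtain A B D E where lh: "w \<in> hom C A D" "e \<in> hom C B D" "n \<in> hom C E A" "k \<in> hom C E B"
    using pullbackE[OF l] .
  obtain D' H K B' where "t \<in> hom C D' K" "e' \<in> hom C H K" "e \<in> hom C B' D'" "f \<in> hom C B' H"
    using pullbackE[OF r] .
  with lh(2) have rh: "t \<in> hom C D K" "e' \<in> hom C H K" "f \<in> hom C B H" by (auto simp: hom_def)
  show ?thesis
  proof (rule is_pullbackI[OF comp_hom[OF lh(1) rh(1)] rh(2) lh(3) comp_hom[OF lh(4) rh(3)]])
    have "(t \<cdot> w) \<cdot> n = t \<cdot> (e \<cdot> k)"
      using comp_assoc[OF lh(3,1) rh(1)] pullback_commutes[OF l] by simp
    also have "\<dots> = e' \<cdot> (f \<cdot> k)"
      using comp_assoc[OF lh(4,2) rh(1)] comp_assoc[OF lh(4) rh(3,2)] pullback_commutes[OF r] by simp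
    finally show "(t \<cdot> w) \<cdot> n = e' \<cdot> (f \<cdot> k)" .
  next
    fix z x y assume x: "x \<in> hom C z A" and y: "y \<in> hom C z H" and xy: "t \<cdot> w \<cdot> x = e' \<cdot> y"
    have "t \<cdot> (w \<cdot> x) = e' \<cdot> y" using comp_assoc[OF x lh(1) rh(1)] xy by simp
    then obtain u where u: "u \<in> hom C z B" "e \<cdot> u = w \<cdot> x" "f \<cdot> u = y"
      using pullback_lift[OF r lh(2) rh(3) comp_hom[OF x lh(1)] y] by blast
    obtain v where v: "v \<in> hom C z E" "n \<cdot> v = x" "k \<cdot> v = u"
      using pullback_lift[OF l lh(3,4) x u(1) u(2)[symmetric]] by blast
    then show "\<exists>v \<in> hom C z E. n \<cdot> v = x \<and> f \<cdot> k \<cdot> v = y"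
      using comp_assoc[OF v(1) lh(4) rh(3)] u by auto
  next
    fix z v v' assume v: "v \<in> hom C z E" and v': "v' \<in> hom C z E" and eq: "n \<cdot> v = n \<cdot> v'"
      and "f \<cdot> k \<cdot> v = f \<cdot> k \<cdot> v'"
    then have f: "f \<cdot> (k \<cdot> v) = f \<cdot> (k \<cdot> v')"
      using comp_assoc[OF v lh(4) rh(3)] comp_assoc[OF v' lh(4) rh(3)] by simp
    \<comment> \<open>Joint monicity in the square on \<open>t\<close> asks for agreement after
      \<open>e\<close> as well; it is inherited from agreement after \<open>n\<close> because
      \<open>e \<cdot> k = w \<cdot> n\<close>.\<close>
    have "e \<cdot> (k \<cdot> v) = e \<cdot> (k \<cdot> v')"
      using comp_assoc[OF v lh(4,2)] comp_assoc[OF v' lh(4,2)]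
        comp_assoc[OF v lh(3,1)] comp_assoc[OF v' lh(3,1)] pullback_commutes[OF l] eq by simp
    from pullback_jointly_monic[OF r lh(2) comp_hom[OF v lh(4)] comp_hom[OF v' lh(4)] this f]
    show "v = v'" by (rule pullback_jointly_monic[OF l lh(3) v v' eq])
  qed
qed

text \<open>Converse to pasting: composing the second leg of a cone over \<open>w\<close> and
  \<open>e\<close> with \<open>f\<close> gives a cone over the outer cospan, and the outer square
  lifts it.\<close>

lemma pullback_cancel:
  assumes o: "is_pullback C n (f \<cdot> k) (t \<cdot> w) e'" and r: "is_pullback C e f t e'"
    and w: "w \<in> hom C A D" and e: "e \<in> hom C B D" and n: "n \<in> hom C E A" and k: "k \<in> hom C E B"
    and comm: "w \<cdot> n = e \<cdot> k"
  shows "is_pullback C n k w e"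
proof -
  obtain D' H K B' where "t \<in> hom C D' K" "e' \<in> hom C H K" "e \<in> hom C B' D'" "f \<in> hom C B' H"
    using pullbackE[OF r] .
  with e have rh: "t \<in> hom C D K" "e' \<in> hom C H K" "f \<in> hom C B H" by (auto simp: hom_def)
  show ?thesis
  proof (rule is_pullbackI[OF w e n k comm])
    fix z x y assume x: "x \<in> hom C z A" and y: "y \<in> hom C z B" and xy: "w \<cdot> x = e \<cdot> y"
    have "t \<cdot> w \<cdot> x = e' \<cdot> (f \<cdot> y)"
      using comp_assoc[OF x w rh(1)] comp_assoc[OF y e rh(1)] comp_assoc[OF y rh(3,2)] xy
        pullback_commutes[OF r] by simp
    then obtain v where v: "v \<in> hom C z E" "n \<cdot> v = x" "f \<cdot> k \<cdot> v = f \<cdot> y"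
      using pullback_lift[OF o n comp_hom[OF k rh(3)] x comp_hom[OF y rh(3)]] by blast
    \<comment> \<open>The outer square yields \<open>k \<cdot> v = y\<close> only after
      \<open>f\<close>; commutativity of the inner square supplies it after \<open>e\<close>, and
      \<open>e\<close>, \<open>f\<close> are jointly monic.\<close>
    have "f \<cdot> (k \<cdot> v) = f \<cdot> y" using comp_assoc[OF v(1) k rh(3)] v(3) by simp
    moreover have "e \<cdot> (k \<cdot> v) = e \<cdot> y"
      using comp_assoc[OF v(1) k e] comp_assoc[OF v(1) n w] comm v(2) xy by simp
    ultimately have "k \<cdot> v = y"
      using pullback_jointly_monic[OF r e comp_hom[OF v(1) k] y] by blast
    with v show "\<exists>v \<in> hom C z E. n \<cdot> v = x \<and> k \<cdot> v = y" by blast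
  next
    fix z v v' assume v: "v \<in> hom C z E" and v': "v' \<in> hom C z E" and eq: "n \<cdot> v = n \<cdot> v'"
      and "k \<cdot> v = k \<cdot> v'"
    then have "f \<cdot> k \<cdot> v = f \<cdot> k \<cdot> v'"
      using comp_assoc[OF v k rh(3)] comp_assoc[OF v' k rh(3)] by simp
    then show "v = v'" by (rule pullback_jointly_monic[OF o n v v' eq])
  qed
qed

text \<open>The inverse is the mediating arrow in the opposite direction; both composites preserve
  the projections, hence are identities by joint monicity.\<close>

lemma pullback_comparison_iso:
  assumes P: "is_pullback C p q f g" and P': "is_pullback C p' q' f g"
    and p: "p \<in> hom C d a" and p': "p' \<in> hom C d' a"
    and v: "v \<in> hom C d d'" and vp: "p' \<cdot> v = p" and vq: "q' \<cdot> v = q"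
  shows "is_iso C v"
proof -
  obtain b where q: "q \<in> hom C d b" and q': "q' \<in> hom C d' b"
    using P P' p p' by (auto simp: is_pullback_def hom_def)
  obtain w where w: "w \<in> hom C d' d" "p \<cdot> w = p'" "q \<cdot> w = q'"
    using pullback_lift[OF P p q p' q' pullback_commutes[OF P']] by blast
  have d: "d \<in> obj C" "d' \<in> obj C" using obj_of_hom[OF v] .
  have "w \<cdot> v = ide C d"
  proof (rule pullback_jointly_monic[OF P p comp_hom[OF v w(1)] ide_hom[OF d(1)]])
    show "p \<cdot> (w \<cdot> v) = p \<cdot> ide C d" using comp_assoc[OF v w(1) p] w vp comp_ide[OF p] by simp
    show "q \<cdot> (w \<cdot> v) = q \<cdot> ide C d" using comp_assoc[OF v w(1) q] w vq comp_ide[OF q] by simp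
  qed
  moreover have "v \<cdot> w = ide C d'"
  proof (rule pullback_jointly_monic[OF P' p' comp_hom[OF w(1) v] ide_hom[OF d(2)]])
    show "p' \<cdot> (v \<cdot> w) = p' \<cdot> ide C d'" using comp_assoc[OF w(1) v p'] w vp comp_ide[OF p'] by simp
    show "q' \<cdot> (v \<cdot> w) = q' \<cdot> ide C d'" using comp_assoc[OF w(1) v q'] w vq comp_ide[OF q'] by simp
  qed
  ultimately show ?thesis by (rule is_isoI[OF v w(1)])
qed

section \<open>Slice categories\<close>

lemma slice_simps:
  "f \<in> obj (slice C X) \<longleftrightarrow> f \<in> hom C (src C f) X"
  "src (slice C X) (f, k, g) = f"
  "tgt (slice C X) (f, k, g) = g"
  "ide (slice C X) f = (f, ide C (src C f), f)"
  "(f', k', g') \<cdot>\<^bsub>slice C X\<^esub> (f, k, g) = (f, k' \<cdot> k, g')"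
  by (auto simp: slice_def hom_def)

lemma slice_arr:
  "(f, k, g) \<in> arr (slice C X) \<longleftrightarrow>
    f \<in> hom C (src C f) X \<and> g \<in> hom C (src C g) X \<and> k \<in> hom C (src C f) (src C g) \<and> g \<cdot> k = f"
  by (auto simp: slice_def hom_def)

lemma slice_hom:
  "t \<in> hom (slice C X) f g \<longleftrightarrow> (\<exists>k. t = (f, k, g) \<and> f \<in> hom C (src C f) X \<and>
     g \<in> hom C (src C g) X \<and> k \<in> hom C (src C f) (src C g) \<and> g \<cdot> k = f)"
  by (cases t) (auto simp: hom_def[of "slice C X"] slice_simps slice_arr)

lemma slice_category: "is_category (slice C X)"
  unfolding is_category_def
proof (intro conjI ballI impI)
  fix t assume "t \<in> arr (slice C X)"
  then obtain f k g where t: "t = (f, k, g)" and h: "f \<in> hom C (src C f) X" "g \<in> hom C (src C g) X"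
    "k \<in> hom C (src C f) (src C g)" "g \<cdot> k = f"
    by (cases t) (auto simp: slice_arr)
  show "src (slice C X) t \<in> obj (slice C X)" "tgt (slice C X) t \<in> obj (slice C X)"
    using t h by (auto simp: slice_simps)
  show "t \<cdot>\<^bsub>slice C X\<^esub> ide (slice C X) (src (slice C X) t) = t"
    "ide (slice C X) (tgt (slice C X) t) \<cdot>\<^bsub>slice C X\<^esub> t = t"
    using comp_ide[OF h(3)] ide_comp[OF h(3)] by (auto simp: slice_simps t)
next
  fix f assume "f \<in> obj (slice C X)"
  then have f: "f \<in> hom C (src C f) X" by (simp add: slice_simps)
  then show "ide (slice C X) f \<in> hom (slice C X) f f"
    using ide_hom[OF obj_of_hom(1)[OF f]] comp_ide[OF f] by (auto simp: slice_hom slice_simps)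
next
  fix s t assume "s \<in> arr (slice C X)" "t \<in> arr (slice C X)" "tgt (slice C X) s = src (slice C X) t"
  then obtain f k g l h where st: "s = (f, k, g)" "t = (g, l, h)"
    and a: "f \<in> hom C (src C f) X" "g \<in> hom C (src C g) X" "h \<in> hom C (src C h) X"
      "k \<in> hom C (src C f) (src C g)" "l \<in> hom C (src C g) (src C h)" "g \<cdot> k = f" "h \<cdot> l = g"
    by (cases s; cases t) (auto simp: slice_arr slice_simps)
  have "h \<cdot> (l \<cdot> k) = f" using comp_assoc[OF a(4,5,3)] a(6,7) by simp
  then show "t \<cdot>\<^bsub>slice C X\<^esub> s \<in> hom (slice C X) (src (slice C X) s) (tgt (slice C X) t)"
    using comp_hom[OF a(4,5)] a(1,3) by (simp add: slice_hom slice_simps st)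
next
  fix s t u assume a: "s \<in> arr (slice C X)" "t \<in> arr (slice C X)" "u \<in> arr (slice C X)"
    "tgt (slice C X) s = src (slice C X) t" "tgt (slice C X) t = src (slice C X) u"
  obtain f k g where s: "s = (f, k, g)" by (cases s)
  obtain g' l h where t: "t = (g', l, h)" by (cases t)
  obtain h' p i where u: "u = (h', p, i)" by (cases u)
  have "g = g'" "h = h'" using a(4,5) by (simp_all add: s t u slice_simps)
  then have "k \<in> hom C (src C f) (src C g)" "l \<in> hom C (src C g) (src C h)"
    "p \<in> hom C (src C h) (src C i)"
    using a(1-3) unfolding s t u slice_arr by simp_all
  then show "u \<cdot>\<^bsub>slice C X\<^esub> t \<cdot>\<^bsub>slice C X\<^esub> s = u \<cdot>\<^bsub>slice C X\<^esub> (t \<cdot>\<^bsub>slice C X\<^esub> s)"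
    by (simp add: s t u slice_simps comp_assoc)
qed

text \<open>The inverse \<open>l\<close> of \<open>k\<close> in \<open>C\<close> is automatically an
  arrow over \<open>X\<close>, since \<open>f \<cdot> l = g \<cdot> k \<cdot> l = g\<close>.\<close>

lemma slice_is_iso:
  assumes t: "(f, k, g) \<in> arr (slice C X)" and k: "is_iso C k"
  shows "is_iso (slice C X) (f, k, g)"
proof -
  interpret S: cat "slice C X" by unfold_locales (rule slice_category)
  from t have h: "f \<in> hom C (src C f) X" "g \<in> hom C (src C g) X" "k \<in> hom C (src C f) (src C g)"
    "g \<cdot> k = f" by (auto simp: slice_arr)
  obtain l where l: "l \<in> hom C (src C g) (src C f)" "l \<cdot> k = ide C (src C f)" "k \<cdot> l = ide C (src C g)"
    using is_isoE[OF k h(3)] .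
  have "f \<cdot> l = g" using comp_assoc[OF l(1) h(3,2)] l(3) h(4) comp_ide[OF h(2)] by simp
  then show ?thesis
    using h l by (intro S.is_isoI[of _ f g "(g, l, f)"]) (auto simp: slice_hom slice_simps)
qed

end

section \<open>Functors, natural transformations, and adjunctions from a universal counit\<close>

lemma functor_hom: "is_functor C D F \<Longrightarrow> f \<in> hom C x y \<Longrightarrow> amap F f \<in> hom D (omap F x) (omap F y)"
  by (auto simp: is_functor_def hom_def[of C])

lemma functor_comp:
  "is_functor C D F \<Longrightarrow> f \<in> hom C x y \<Longrightarrow> g \<in> hom C y z \<Longrightarrow>
    amap F (g \<cdot>\<^bsub>C\<^esub> f) = amap F g \<cdot>\<^bsub>D\<^esub> amap F f"
  by (auto simp: is_functor_def hom_def[of C])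

lemma functor_ide: "is_functor C D F \<Longrightarrow> x \<in> obj C \<Longrightarrow> amap F (ide C x) = ide D (omap F x)"
  by (simp add: is_functor_def)

lemma functor_obj: "is_functor C D F \<Longrightarrow> x \<in> obj C \<Longrightarrow> omap F x \<in> obj D"
  by (simp add: is_functor_def)

lemma functor_category: "is_functor C D F \<Longrightarrow> is_category C" "is_functor C D F \<Longrightarrow> is_category D"
  by (auto simp: is_functor_def)

lemma is_functorI:
  assumes "is_category C" "is_category D"
    and "\<And>x. x \<in> obj C \<Longrightarrow> omap F x \<in> obj D"
    and "\<And>x. x \<in> obj C \<Longrightarrow> amap F (ide C x) = ide D (omap F x)"
    and "\<And>f x y. f \<in> hom C x y \<Longrightarrow> amap F f \<in> hom D (omap F x) (omap F y)"
    and "\<And>f g x y z. f \<in> hom C x y \<Longrightarrow> g \<in> hom C y z \<Longrightarrow>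
      amap F (g \<cdot>\<^bsub>C\<^esub> f) = amap F g \<cdot>\<^bsub>D\<^esub> amap F f"
  shows "is_functor C D F"
  unfolding is_functor_def using assms by (simp add: hom_def)

lemma comp_functor_simps:
  "omap (G \<circ>\<^sub>F F) x = omap G (omap F x)" "amap (G \<circ>\<^sub>F F) f = amap G (amap F f)"
  by (simp_all add: comp_functor_def)

lemma id_functor_simps: "omap id_functor x = x" "amap id_functor f = f"
  by (simp_all add: id_functor_def)

lemma id_functor_is_functor: "is_category C \<Longrightarrow> is_functor C C id_functor"
  by (rule is_functorI) (auto simp: id_functor_simps)

lemma comp_functor_is_functor:
  "is_functor C D F \<Longrightarrow> is_functor D E G \<Longrightarrow> is_functor C E (G \<circ>\<^sub>F F)"
  unfolding is_functor_def[of C E] is_functor_def[of C D] is_functor_def[of D E]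
  by (simp add: comp_functor_simps hom_def)

lemma natural_transformation_hom:
  "natural_transformation C D F G \<tau> \<Longrightarrow> x \<in> obj C \<Longrightarrow> \<tau> x \<in> hom D (omap F x) (omap G x)"
  by (simp add: natural_transformation_def)

lemma natural_transformation_natural:
  "natural_transformation C D F G \<tau> \<Longrightarrow> f \<in> hom C x y \<Longrightarrow>
    amap G f \<cdot>\<^bsub>D\<^esub> \<tau> x = \<tau> y \<cdot>\<^bsub>D\<^esub> amap F f"
  by (auto simp: natural_transformation_def hom_def[of C])

lemma natural_transformationI:
  assumes "is_functor C D F" "is_functor C D G"
    and "\<And>x. x \<in> obj C \<Longrightarrow> \<tau> x \<in> hom D (omap F x) (omap G x)"
    and "\<And>f x y. f \<in> hom C x y \<Longrightarrow> amap G f \<cdot>\<^bsub>D\<^esub> \<tau> x = \<tau> y \<cdot>\<^bsub>D\<^esub> amap F f"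
  shows "natural_transformation C D F G \<tau>"
  unfolding natural_transformation_def using assms by (simp add: hom_def)

text \<open>Reduces an adjunction to unique factorization through the counit. The unit arises by
  factoring identities; its naturality and the second triangle law follow from uniqueness of
  factorizations.\<close>

lemma adjunction_of_universal_counit:
  assumes F: "is_functor C D F" and G: "is_functor D C G"
    and e: "natural_transformation D D (F \<circ>\<^sub>F G) id_functor e"
    and univ: "\<And>x y g. x \<in> obj C \<Longrightarrow> y \<in> obj D \<Longrightarrow> g \<in> hom D (omap F x) y \<Longrightarrow>
      \<exists>!f. f \<in> hom C x (omap G y) \<and> e y \<cdot>\<^bsub>D\<^esub> amap F f = g"
  shows "\<exists>u. adjunction C D F G u e"
proof -
  interpret C: cat C by unfold_locales (rule functor_category[OF F])
  interpret D: cat D by unfold_locales (rule functor_category[OF F])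
  have e_hom: "e y \<in> hom D (omap F (omap G y)) y" if "y \<in> obj D" for y
    using natural_transformation_hom[OF e that] by (simp add: comp_functor_simps id_functor_simps)
  have e_nat: "g \<cdot>\<^bsub>D\<^esub> e y = e y' \<cdot>\<^bsub>D\<^esub> amap F (amap G g)" if "g \<in> hom D y y'" for g y y'
    using natural_transformation_natural[OF e that] by (simp add: comp_functor_simps id_functor_simps)
  \<comment> \<open>The unit at \<open>x\<close> factors the identity of \<open>omap F x\<close>;
    the equation defining it is already the first triangle law.\<close>
  define u where "u x = (THE f. f \<in> hom C x (omap G (omap F x)) \<and>
    e (omap F x) \<cdot>\<^bsub>D\<^esub> amap F f = ide D (omap F x))" for x
  have u: "u x \<in> hom C x (omap G (omap F x))"
    "e (omap F x) \<cdot>\<^bsub>D\<^esub> amap F (u x) = ide D (omap F x)" if x: "x \<in> obj C" for x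
    using theI'[OF univ[OF x functor_obj[OF F x] D.ide_hom[OF functor_obj[OF F x]]]]
    unfolding u_def by auto
  \<comment> \<open>An arrow into \<open>omap G y\<close> is determined by its transpose
    \<open>e y \<cdot> amap F f\<close>; the two remaining laws are proved by comparing
    transposes.\<close>
  have uniq: "f = f'" if "f \<in> hom C x (omap G y)" "f' \<in> hom C x (omap G y)" "y \<in> obj D"
    "e y \<cdot>\<^bsub>D\<^esub> amap F f = e y \<cdot>\<^bsub>D\<^esub> amap F f'" for x y f f'
  proof -
    have "e y \<cdot>\<^bsub>D\<^esub> amap F f \<in> hom D (omap F x) y"
      using D.comp_hom[OF functor_hom[OF F that(1)] e_hom[OF that(3)]] .
    from univ[OF C.obj_of_hom(1)[OF that(1)] that(3) this] that show ?thesis by metis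
  qed
  have u_nat: "amap G (amap F f) \<cdot>\<^bsub>C\<^esub> u x = u x' \<cdot>\<^bsub>C\<^esub> f" if f: "f \<in> hom C x x'" for f x x'
  proof -
    have x: "x \<in> obj C" "x' \<in> obj C" using C.obj_of_hom[OF f] .
    note Ff = functor_hom[OF F f]
    note GFf = functor_hom[OF G Ff]
    have Fx: "omap F x \<in> obj D" "omap F x' \<in> obj D" using functor_obj[OF F] x by auto
    show ?thesis
    proof (rule uniq[OF C.comp_hom[OF u(1)[OF x(1)] GFf] C.comp_hom[OF f u(1)[OF x(2)]] Fx(2)])
      \<comment> \<open>By naturality of \<open>e\<close> and the equation defining
        \<open>u\<close>, the transpose of either side reduces to \<open>amap F f\<close>.\<close>
      have "e (omap F x') \<cdot>\<^bsub>D\<^esub> amap F (amap G (amap F f) \<cdot>\<^bsub>C\<^esub> u x) =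
          e (omap F x') \<cdot>\<^bsub>D\<^esub> amap F (amap G (amap F f)) \<cdot>\<^bsub>D\<^esub> amap F (u x)"
        using functor_comp[OF F u(1)[OF x(1)] GFf]
          D.comp_assoc[OF functor_hom[OF F u(1)[OF x(1)]] functor_hom[OF F GFf] e_hom[OF Fx(2)]]
        by simp
      also have "\<dots> = amap F f \<cdot>\<^bsub>D\<^esub> (e (omap F x) \<cdot>\<^bsub>D\<^esub> amap F (u x))"
        using e_nat[OF Ff] D.comp_assoc[OF functor_hom[OF F u(1)[OF x(1)]] e_hom[OF Fx(1)] Ff] by simp
      also have "\<dots> = e (omap F x') \<cdot>\<^bsub>D\<^esub> amap F (u x') \<cdot>\<^bsub>D\<^esub> amap F f"
        using u(2)[OF x(1)] u(2)[OF x(2)] D.comp_ide[OF Ff] D.ide_comp[OF Ff] by simp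
      also have "\<dots> = e (omap F x') \<cdot>\<^bsub>D\<^esub> amap F (u x' \<cdot>\<^bsub>C\<^esub> f)"
        using functor_comp[OF F f u(1)[OF x(2)]]
          D.comp_assoc[OF Ff functor_hom[OF F u(1)[OF x(2)]] e_hom[OF Fx(2)]] by simp
      finally show "e (omap F x') \<cdot>\<^bsub>D\<^esub> amap F (amap G (amap F f) \<cdot>\<^bsub>C\<^esub> u x) =
        e (omap F x') \<cdot>\<^bsub>D\<^esub> amap F (u x' \<cdot>\<^bsub>C\<^esub> f)" .
    qed
  qed
  have triangle: "amap G (e y) \<cdot>\<^bsub>C\<^esub> u (omap G y) = ide C (omap G y)" if y: "y \<in> obj D" for y
  proof -
    have Gy: "omap G y \<in> obj C" and FGy: "omap F (omap G y) \<in> obj D"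
      using functor_obj[OF G y] functor_obj[OF F] by auto
    note Ge = functor_hom[OF G e_hom[OF y]]
    note uGy = u(1)[OF Gy]
    show ?thesis
    proof (rule uniq[OF C.comp_hom[OF uGy Ge] C.ide_hom[OF Gy] y])
      \<comment> \<open>Both sides have transpose \<open>e y\<close>; on the left, naturality of
        \<open>e\<close> at the arrow \<open>e y\<close> itself exposes the first triangle law at
        \<open>omap G y\<close>.\<close>
      have "e y \<cdot>\<^bsub>D\<^esub> amap F (amap G (e y) \<cdot>\<^bsub>C\<^esub> u (omap G y)) =
          e y \<cdot>\<^bsub>D\<^esub> amap F (amap G (e y)) \<cdot>\<^bsub>D\<^esub> amap F (u (omap G y))"
        using functor_comp[OF F uGy Ge]
          D.comp_assoc[OF functor_hom[OF F uGy] functor_hom[OF F Ge] e_hom[OF y]] by simp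
      also have "\<dots> = e y \<cdot>\<^bsub>D\<^esub> (e (omap F (omap G y)) \<cdot>\<^bsub>D\<^esub> amap F (u (omap G y)))"
        using e_nat[OF e_hom[OF y]] D.comp_assoc[OF functor_hom[OF F uGy] e_hom[OF FGy] e_hom[OF y]]
        by simp
      also have "\<dots> = e y \<cdot>\<^bsub>D\<^esub> amap F (ide C (omap G y))"
        using u(2)[OF Gy] functor_ide[OF F Gy] by simp
      finally show "e y \<cdot>\<^bsub>D\<^esub> amap F (amap G (e y) \<cdot>\<^bsub>C\<^esub> u (omap G y)) =
        e y \<cdot>\<^bsub>D\<^esub> amap F (ide C (omap G y))" .
    qed
  qed
  have "natural_transformation C C id_functor (G \<circ>\<^sub>F F) u"
    using comp_functor_is_functor[OF F G] id_functor_is_functor[OF C.is_cat] u(1) u_nat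
    by (intro natural_transformationI) (auto simp: comp_functor_simps id_functor_simps)
  then show ?thesis
    unfolding adjunction_def using F G e u(2) triangle by (intro exI[of _ u]) blast
qed

section \<open>The functor that \<open>T\<close> induces between slices\<close>

context cat
begin

lemma slice_map_functor:
  assumes T: "is_functor C C T"
  shows "is_functor (slice C X) (slice C (omap T X)) (slice_map T)"
proof (rule is_functorI[OF slice_category slice_category])
  have map: "amap T f \<in> hom C (src C (amap T f)) (omap T X) \<and> src C (amap T f) = omap T (src C f)"
    if "f \<in> hom C (src C f) X" for f
    using functor_hom[OF T that] by (auto simp: hom_def)
  fix f assume f: "f \<in> obj (slice C X)"
  then have fh: "f \<in> hom C (src C f) X" by (simp add: slice_simps)
  show "omap (slice_map T) f \<in> obj (slice C (omap T X))"
    using conjunct1[OF map[OF fh]] by (simp add: slice_map_def slice_simps)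
  show "amap (slice_map T) (ide (slice C X) f) = ide (slice C (omap T X)) (omap (slice_map T) f)"
    using map[OF fh] functor_ide[OF T obj_of_hom(1)[OF fh]] by (simp add: slice_map_def slice_simps)
next
  fix t f g assume "t \<in> hom (slice C X) f g"
  then obtain k where t: "t = (f, k, g)" and h: "f \<in> hom C (src C f) X" "g \<in> hom C (src C g) X"
    "k \<in> hom C (src C f) (src C g)" "g \<cdot> k = f" by (auto simp: slice_hom)
  have "amap T g \<cdot> amap T k = amap T f" using functor_comp[OF T h(3,2)] h(4) by simp
  then show "amap (slice_map T) t \<in> hom (slice C (omap T X)) (omap (slice_map T) f) (omap (slice_map T) g)"
    using functor_hom[OF T h(1)] functor_hom[OF T h(2)] functor_hom[OF T h(3)]
    by (auto simp: slice_map_def slice_hom t homD)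
next
  fix s t f g h assume "s \<in> hom (slice C X) f g" "t \<in> hom (slice C X) g h"
  then show "amap (slice_map T) (t \<cdot>\<^bsub>slice C X\<^esub> s) =
      amap (slice_map T) t \<cdot>\<^bsub>slice C (omap T X)\<^esub> amap (slice_map T) s"
    by (auto simp: slice_hom slice_map_def slice_simps functor_comp[OF T])
qed

end

section \<open>Pullback functors for a choice of pullbacks\<close>

locale cat_with_pullbacks = cat +
  fixes \<chi> :: "'b \<Rightarrow> 'b \<Rightarrow> 'b \<times> 'b"
  assumes choice: "pullback_choice C \<chi>"
begin

lemma chosen_pullback:
  assumes "m \<in> hom C a c" "h \<in> hom C b c"
  shows "is_pullback C (fst (\<chi> m h)) (snd (\<chi> m h)) m h"
    and "fst (\<chi> m h) \<in> hom C (src C (fst (\<chi> m h))) a"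
    and "snd (\<chi> m h) \<in> hom C (src C (fst (\<chi> m h))) b"
proof -
  show pb: "is_pullback C (fst (\<chi> m h)) (snd (\<chi> m h)) m h"
    using choice assms by (auto simp: pullback_choice_def hom_def)
  then show "fst (\<chi> m h) \<in> hom C (src C (fst (\<chi> m h))) a"
    "snd (\<chi> m h) \<in> hom C (src C (fst (\<chi> m h))) b"
    using assms by (auto simp: is_pullback_def hom_def)
qed

lemma pb_omap: "omap (pb C \<chi> m) h = fst (\<chi> m h)"
  by (simp add: pb_def)

text \<open>Makes the definite description in \<open>pb\<close> meaningful: following the second
  projection of the pullback of \<open>h\<close> by \<open>k\<close> gives a cone over the cospan of
  \<open>m\<close> and \<open>h'\<close>.\<close>

lemma pb_arrow_ex1:
  assumes m: "m \<in> hom C a c" and h: "h \<in> hom C b c" and h': "h' \<in> hom C b' c"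
    and k: "k \<in> hom C b b'" "h' \<cdot> k = h"
  shows "\<exists>!v. v \<in> hom C (src C (fst (\<chi> m h))) (src C (fst (\<chi> m h'))) \<and>
     fst (\<chi> m h') \<cdot> v = fst (\<chi> m h) \<and> snd (\<chi> m h') \<cdot> v = k \<cdot> snd (\<chi> m h)"
proof -
  note P = chosen_pullback[OF m h] and P' = chosen_pullback[OF m h']
  have "m \<cdot> fst (\<chi> m h) = h' \<cdot> (k \<cdot> snd (\<chi> m h))"
    using pullback_commutes[OF P(1)] comp_assoc[OF P(3) k(1) h'] k(2) by simp
  from pullback_ex1[OF P' P(2) comp_hom[OF P(3) k(1)] this] show ?thesis .
qed

lemma pb_amap:
  assumes m: "m \<in> hom C a c" and h: "h \<in> hom C b c" and h': "h' \<in> hom C b' c"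
    and k: "k \<in> hom C b b'" "h' \<cdot> k = h"
  obtains v where "amap (pb C \<chi> m) (h, k, h') = (fst (\<chi> m h), v, fst (\<chi> m h'))"
    "v \<in> hom C (src C (fst (\<chi> m h))) (src C (fst (\<chi> m h')))"
    "fst (\<chi> m h') \<cdot> v = fst (\<chi> m h)" "snd (\<chi> m h') \<cdot> v = k \<cdot> snd (\<chi> m h)"
  using theI'[OF pb_arrow_ex1[OF assms]] that by (simp add: pb_def)

text \<open>Reduces a value of the functor on arrows to two projection equations; preservation of
  identities and of composites is verified through them.\<close>

lemma pb_amap_eqI:
  assumes m: "m \<in> hom C a c" and h: "h \<in> hom C b c" and h': "h' \<in> hom C b' c"
    and k: "k \<in> hom C b b'" "h' \<cdot> k = h"
    and v: "v \<in> hom C (src C (fst (\<chi> m h))) (src C (fst (\<chi> m h')))"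
    "fst (\<chi> m h') \<cdot> v = fst (\<chi> m h)" "snd (\<chi> m h') \<cdot> v = k \<cdot> snd (\<chi> m h)"
  shows "amap (pb C \<chi> m) (h, k, h') = (fst (\<chi> m h), v, fst (\<chi> m h'))"
  using the1_equality[OF pb_arrow_ex1[OF m h h' k] conjI[OF v(1) conjI[OF v(2,3)]]]
  by (simp add: pb_def)

lemma pb_functor:
  assumes m: "m \<in> hom C a c"
  shows "is_functor (slice C c) (slice C a) (pb C \<chi> m)"
proof (rule is_functorI[OF slice_category slice_category])
  fix h assume "h \<in> obj (slice C c)"
  then have h: "h \<in> hom C (src C h) c" by (simp add: slice_simps)
  note P = chosen_pullback[OF m h]
  show "omap (pb C \<chi> m) h \<in> obj (slice C a)"
    using P(2) by (simp add: slice_simps pb_omap)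
  show "amap (pb C \<chi> m) (ide (slice C c) h) = ide (slice C a) (omap (pb C \<chi> m) h)"
    unfolding slice_simps pb_omap
    by (rule pb_amap_eqI[OF m h h ide_hom[OF obj_of_hom(1)[OF h]] comp_ide[OF h]
          ide_hom[OF obj_of_hom(1)[OF P(2)]]])
      (simp_all add: comp_ide[OF P(2)] comp_ide[OF P(3)] ide_comp[OF P(3)])
next
  fix t h h' assume "t \<in> hom (slice C c) h h'"
  then obtain k where t: "t = (h, k, h')" and h: "h \<in> hom C (src C h) c" "h' \<in> hom C (src C h') c"
    "k \<in> hom C (src C h) (src C h')" "h' \<cdot> k = h" by (auto simp: slice_hom)
  show "amap (pb C \<chi> m) t \<in> hom (slice C a) (omap (pb C \<chi> m) h) (omap (pb C \<chi> m) h')"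
    using chosen_pullback(2)[OF m h(1)] chosen_pullback(2)[OF m h(2)]
    by (rule_tac pb_amap[OF m h]) (simp add: t slice_hom pb_omap)
next
  fix s t x y z assume "s \<in> hom (slice C c) x y" "t \<in> hom (slice C c) y z"
  then obtain k l where s: "s = (x, k, y)" and t: "t = (y, l, z)"
    and x: "x \<in> hom C (src C x) c" and y: "y \<in> hom C (src C y) c" and z: "z \<in> hom C (src C z) c"
    and k: "k \<in> hom C (src C x) (src C y)" "y \<cdot> k = x"
    and l: "l \<in> hom C (src C y) (src C z)" "z \<cdot> l = y"
    by (auto simp: slice_hom)
  note X = chosen_pullback[OF m x] and Y = chosen_pullback[OF m y] and Z = chosen_pullback[OF m z]
  obtain v where v: "amap (pb C \<chi> m) (x, k, y) = (fst (\<chi> m x), v, fst (\<chi> m y))"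
    "v \<in> hom C (src C (fst (\<chi> m x))) (src C (fst (\<chi> m y)))"
    "fst (\<chi> m y) \<cdot> v = fst (\<chi> m x)" "snd (\<chi> m y) \<cdot> v = k \<cdot> snd (\<chi> m x)"
    using pb_amap[OF m x y k] .
  obtain w where w: "amap (pb C \<chi> m) (y, l, z) = (fst (\<chi> m y), w, fst (\<chi> m z))"
    "w \<in> hom C (src C (fst (\<chi> m y))) (src C (fst (\<chi> m z)))"
    "fst (\<chi> m z) \<cdot> w = fst (\<chi> m y)" "snd (\<chi> m z) \<cdot> w = l \<cdot> snd (\<chi> m y)"
    using pb_amap[OF m y z l] .
  have "amap (pb C \<chi> m) (x, l \<cdot> k, z) = (fst (\<chi> m x), w \<cdot> v, fst (\<chi> m z))"
  proof (rule pb_amap_eqI[OF m x z comp_hom[OF k(1) l(1)] _ comp_hom[OF v(2) w(2)]])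
    show "z \<cdot> (l \<cdot> k) = x" using comp_assoc[OF k(1) l(1) z] k l by simp
    show "fst (\<chi> m z) \<cdot> (w \<cdot> v) = fst (\<chi> m x)" using comp_assoc[OF v(2) w(2) Z(2)] v w by simp
    have "snd (\<chi> m z) \<cdot> (w \<cdot> v) = l \<cdot> (snd (\<chi> m y) \<cdot> v)"
      using comp_assoc[OF v(2) w(2) Z(3)] comp_assoc[OF v(2) Y(3) l(1)] w(4) by simp
    then show "snd (\<chi> m z) \<cdot> (w \<cdot> v) = l \<cdot> k \<cdot> snd (\<chi> m x)"
      using v(4) comp_assoc[OF X(3) k(1) l(1)] by simp
  qed
  then show "amap (pb C \<chi> m) (t \<cdot>\<^bsub>slice C c\<^esub> s) =
      amap (pb C \<chi> m) t \<cdot>\<^bsub>slice C a\<^esub> amap (pb C \<chi> m) s"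
    by (simp add: s t slice_simps v(1) w(1))
qed

end

section \<open>Partial map classifiers\<close>

locale partial_map_category = cat_with_pullbacks +
  fixes M :: "'b set" and T :: "('a, 'b, 'a, 'b) prefunctor" and \<eta> :: "'a \<Rightarrow> 'b"
  assumes stable: "stable_system_of_monos C M"
    and classifier: "partial_map_classifier C M T \<eta>"
begin

lemma T_functor: "is_functor C C T"
  using classifier by (simp add: partial_map_classifier_def)

lemma eta_hom: "X \<in> obj C \<Longrightarrow> \<eta> X \<in> hom C X (omap T X)"
  using classifier natural_transformation_hom[of C C id_functor T \<eta> X]
  by (simp add: partial_map_classifier_def id_functor_simps)

lemma eta_natural: "f \<in> hom C X Y \<Longrightarrow> amap T f \<cdot> \<eta> X = \<eta> Y \<cdot> f"
  using classifier natural_transformation_natural[of C C id_functor T \<eta> f X Y]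
  by (simp add: partial_map_classifier_def id_functor_simps)

lemma eta_cartesian: "f \<in> hom C X Y \<Longrightarrow> is_pullback C (\<eta> X) f (amap T f) (\<eta> Y)"
  using classifier by (auto simp: partial_map_classifier_def hom_def)

lemma classify_ex1:
  assumes "n \<in> M" "n \<in> hom C X Z" "f \<in> hom C X Y"
  shows "\<exists>!k. k \<in> hom C Z (omap T Y) \<and> is_pullback C n f k (\<eta> Y)"
  using classifier assms unfolding partial_map_classifier_def classifies_def
  by (metis (no_types, lifting) homD)

text \<open>The means of proving arrows into \<open>omap T Y\<close> equal: exhibit pullback squares
  showing that both classify the same partial map.\<close>

lemma classify_unique:
  assumes "n \<in> M" "n \<in> hom C X Z" "f \<in> hom C X Y"
    and "k \<in> hom C Z (omap T Y)" "is_pullback C n f k (\<eta> Y)"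
    and "k' \<in> hom C Z (omap T Y)" "is_pullback C n f k' (\<eta> Y)"
  shows "k = k'"
  using classify_ex1[OF assms(1-3)] assms(4-7) by blast

lemma stable_pullback: "n \<in> M \<Longrightarrow> is_pullback C p q f n \<Longrightarrow> p \<in> M"
  using stable unfolding stable_system_of_monos_def by blast

lemma classifying_bar:
  assumes "m \<in> M" "m \<in> hom C L G"
  shows "classifying_bar C T \<eta> m \<in> hom C G (omap T L)"
    and "is_pullback C m (ide C L) (classifying_bar C T \<eta> m) (\<eta> L)"
proof -
  have L: "L \<in> obj C" using obj_of_hom[OF assms(2)] by blast
  note i = ide_hom[OF L]
  from theI'[OF classify_ex1[OF assms i]]
  show "classifying_bar C T \<eta> m \<in> hom C G (omap T L)"
    "is_pullback C m (ide C L) (classifying_bar C T \<eta> m) (\<eta> L)"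
    using homD[OF assms(2)] homD[OF i]
    by (auto simp: classifying_bar_def classifying_arrow_def classifies_def)
qed

end

section \<open>The pullbacks relating \<open>m\<close>, its classifying arrow and
  \<open>\<eta>\<close>\<close>

locale fpbc_setting = partial_map_category +
  fixes L G :: 'a and m :: 'b
  assumes m_M: "m \<in> M" and m_hom: "m \<in> hom C L G"
begin

definition bar where "bar = classifying_bar C T \<eta> m"

lemma bar: "bar \<in> hom C G (omap T L)" "is_pullback C m (ide C L) bar (\<eta> L)"
  using classifying_bar[OF m_M m_hom] by (simp_all add: bar_def)

lemma L_obj: "L \<in> obj C"
  using obj_of_hom[OF m_hom] by blast

text \<open>The remaining leg of the square classifying \<open>m\<close> is an identity.\<close>

lemma bar_m: "bar \<cdot> m = \<eta> L"
  using pullback_commutes[OF bar(2)] comp_ide[OF eta_hom[OF L_obj]] by simp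

text \<open>\<open>R f\<close> is the right adjoint on objects, \<open>Q f\<close> the other projection of its pullback square.\<close>

definition R where "R f = fst (\<chi> bar (amap T f))"

definition Q where "Q f = snd (\<chi> bar (amap T f))"

lemma fpbc_omap: "omap (fpbc C \<chi> T \<eta> m) f = R f"
  by (simp add: fpbc_def comp_functor_simps pb_omap slice_map_def R_def bar_def)

lemma R_pullback:
  assumes "f \<in> hom C Y L"
  shows "is_pullback C (R f) (Q f) bar (amap T f)"
    and "R f \<in> hom C (src C (R f)) G" and "Q f \<in> hom C (src C (R f)) (omap T Y)"
  using chosen_pullback[OF bar(1) functor_hom[OF T_functor assms]] by (simp_all add: R_def Q_def)

text \<open>\<open>S h\<close> is the pullback of \<open>h\<close> along \<open>m\<close>, \<open>N h\<close> the other projection.\<close>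

definition S where "S h = fst (\<chi> m h)"

definition N where "N h = snd (\<chi> m h)"

lemma S_pullback:
  assumes "h \<in> hom C W G"
  shows "is_pullback C (S h) (N h) m h"
    and "S h \<in> hom C (src C (S h)) L" and "N h \<in> hom C (src C (S h)) W"
  using chosen_pullback[OF m_hom assms] by (simp_all add: S_def N_def)

lemma N_M: "h \<in> hom C W G \<Longrightarrow> N h \<in> M"
  using stable_pullback[OF m_M pullback_swap[OF S_pullback(1)]] .

lemma bar_classifies:
  assumes h: "h \<in> hom C W G"
  shows "is_pullback C (N h) (S h) (bar \<cdot> h) (\<eta> L)"
  using pullback_paste[OF pullback_swap[OF S_pullback(1)[OF h]] bar(2)]
    ide_comp[OF S_pullback(2)[OF h]] by simp

section \<open>The counit and its invertibility\<close>

definition is_counit where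
  "is_counit f k \<longleftrightarrow> k \<in> hom C (src C (S (R f))) (src C f) \<and> f \<cdot> k = S (R f) \<and>
     \<eta> (src C f) \<cdot> k = Q f \<cdot> N (R f)"

text \<open>Pulling back along \<open>bar\<close> and then along \<open>m\<close> amounts to pulling
  back along \<open>bar \<cdot> m\<close>, which is \<open>\<eta> L\<close>.\<close>

lemma SR_pullback:
  assumes f: "f \<in> hom C Y L"
  shows "is_pullback C (S (R f)) (Q f \<cdot> N (R f)) (\<eta> L) (amap T f)"
  using pullback_paste[OF S_pullback(1)[OF R_pullback(2)[OF f]] R_pullback(1)[OF f]] bar_m by simp

text \<open>The equations in \<open>is_counit\<close> prescribe the composites with \<open>f\<close>
  and \<open>\<eta> Y\<close>, the projections of the cartesian naturality square of
  \<open>f : Y \<rightarrow> L\<close>. They have exactly one solution, so \<open>SOME\<close> picks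
  the canonical comparison arrow.\<close>

definition counit where "counit f = (SOME k. is_counit f k)"

text \<open>The projections in \<open>SR_pullback\<close> form a cone over \<open>\<eta> L\<close>
  and \<open>amap T f\<close>, and the naturality square of \<open>f\<close>, being a pullback,
  lifts it.\<close>

lemma counit:
  assumes f: "f \<in> hom C Y L"
  shows "counit f \<in> hom C (src C (S (R f))) Y" and "f \<cdot> counit f = S (R f)"
    and "\<eta> Y \<cdot> counit f = Q f \<cdot> N (R f)"
proof -
  note P = pullback_swap[OF eta_cartesian[OF f]]
  note r = R_pullback[OF f]
  note s = S_pullback[OF r(2)]
  obtain k where "k \<in> hom C (src C (S (R f))) Y" "f \<cdot> k = S (R f)" "\<eta> Y \<cdot> k = Q f \<cdot> N (R f)"
    using pullback_lift[OF P f eta_hom[OF obj_of_hom(1)[OF f]] s(2) comp_hom[OF s(3) r(3)]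
        pullback_commutes[OF SR_pullback[OF f]]] .
  then have "is_counit f k" using homD[OF f] by (simp add: is_counit_def)
  then have "is_counit f (counit f)" unfolding counit_def by (rule someI)
  then show "counit f \<in> hom C (src C (S (R f))) Y" "f \<cdot> counit f = S (R f)"
    "\<eta> Y \<cdot> counit f = Q f \<cdot> N (R f)" using homD[OF f] by (simp_all add: is_counit_def)
qed

text \<open>\<open>counit f\<close> respects the projections of two pullbacks of one cospan, given
  by \<open>\<eta> L\<close> and \<open>amap T f\<close>.\<close>

lemma counit_iso:
  assumes f: "f \<in> hom C Y L"
  shows "is_iso C (counit f)"
  using pullback_comparison_iso[OF SR_pullback[OF f] pullback_swap[OF eta_cartesian[OF f]]
      S_pullback(2)[OF R_pullback(2)[OF f]] f counit[OF f]] .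

section \<open>Transposition by classifying partial maps\<close>

lemma classifies_over_bar:
  assumes f: "f \<in> hom C Y L" and h: "h \<in> hom C W G" and k: "k \<in> hom C (src C (S h)) Y"
    and fk: "f \<cdot> k = S h"
    and w: "w \<in> hom C W (omap T Y)" "is_pullback C (N h) k w (\<eta> Y)"
  shows "amap T f \<cdot> w = bar \<cdot> h"
proof (rule classify_unique[OF N_M[OF h] S_pullback(3,2)[OF h]])
  \<comment> \<open>Both sides classify \<open>(N h, S h)\<close>; for the left one, the square
    classifying \<open>(N h, k)\<close> is pasted with the naturality square of
    \<open>f\<close>.\<close>
  show "is_pullback C (N h) (S h) (amap T f \<cdot> w) (\<eta> L)"
    using pullback_paste[OF w(2) eta_cartesian[OF f]] fk by simp
qed (use comp_hom[OF w(1) functor_hom[OF T_functor f]] comp_hom[OF h bar(1)] bar_classifies[OF h] in auto)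

text \<open>Converse direction: the naturality square of \<open>f\<close> is cancelled from the
  square by which \<open>bar \<cdot> h\<close> classifies \<open>(N h, S h)\<close>.\<close>

lemma over_bar_classifies:
  assumes f: "f \<in> hom C Y L" and h: "h \<in> hom C W G" and k: "k \<in> hom C (src C (S h)) Y"
    and fk: "f \<cdot> k = S h"
    and w: "w \<in> hom C W (omap T Y)" "amap T f \<cdot> w = bar \<cdot> h" "\<eta> Y \<cdot> k = w \<cdot> N h"
  shows "is_pullback C (N h) k w (\<eta> Y)"
  using bar_classifies[OF h] w(2,3) fk
  by (intro pullback_cancel[OF _ eta_cartesian[OF f] w(1) eta_hom[OF obj_of_hom(1)[OF f]]
        S_pullback(3)[OF h] k]) simp_all

text \<open>Core of the adjunction, in terms of \<open>C\<close> alone: \<open>v\<close> is the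
  transpose of \<open>k\<close>, and \<open>Q f \<cdot> v\<close> classifies
  \<open>(N h, k)\<close>. The relation is stated as an equation because
  \<open>counit_transpose\<close> produces that form; \<open>over_bar_classifies\<close> recovers
  the pullback square from it.\<close>

lemma transpose_ex1:
  assumes f: "f \<in> hom C Y L" and h: "h \<in> hom C W G" and k: "k \<in> hom C (src C (S h)) Y"
    and fk: "f \<cdot> k = S h"
  shows "\<exists>!v. v \<in> hom C W (src C (R f)) \<and> R f \<cdot> v = h \<and> \<eta> Y \<cdot> k = Q f \<cdot> v \<cdot> N h"
proof (rule ex_ex1I)
  note r = R_pullback[OF f] and s = S_pullback[OF h]
  \<comment> \<open>The arrow \<open>w\<close> classifying \<open>(N h, k)\<close> lies over
    \<open>bar \<cdot> h\<close>, so \<open>h\<close> and \<open>w\<close> form a cone that lifts to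
    the pullback with projections \<open>R f\<close> and \<open>Q f\<close>.\<close>
  obtain w where w: "w \<in> hom C W (omap T Y)" "is_pullback C (N h) k w (\<eta> Y)"
    using classify_ex1[OF N_M[OF h] s(3) k] by blast
  obtain v where "v \<in> hom C W (src C (R f))" "R f \<cdot> v = h" "Q f \<cdot> v = w"
    using pullback_lift[OF r h w(1) classifies_over_bar[OF assms w, symmetric]] .
  with pullback_commutes[OF w(2)]
  show "\<exists>v. v \<in> hom C W (src C (R f)) \<and> R f \<cdot> v = h \<and> \<eta> Y \<cdot> k = Q f \<cdot> v \<cdot> N h" by auto
  fix v v'
  \<comment> \<open>For uniqueness, the bare equation is upgraded to a classification, so that any
    two solutions agree after \<open>Q f\<close>; after \<open>R f\<close> both give
    \<open>h\<close>.\<close>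
  have cl: "Q f \<cdot> x \<in> hom C W (omap T Y)" "is_pullback C (N h) k (Q f \<cdot> x) (\<eta> Y)"
    if x: "x \<in> hom C W (src C (R f)) \<and> R f \<cdot> x = h \<and> \<eta> Y \<cdot> k = Q f \<cdot> x \<cdot> N h" for x
  proof -
    have xh: "x \<in> hom C W (src C (R f))" using x by blast
    show q: "Q f \<cdot> x \<in> hom C W (omap T Y)" using comp_hom[OF xh r(3)] .
    have "amap T f \<cdot> (Q f \<cdot> x) = bar \<cdot> h"
      using comp_assoc[OF xh r(3) functor_hom[OF T_functor f]] comp_assoc[OF xh r(2) bar(1)]
        pullback_commutes[OF r(1)] x by simp
    from over_bar_classifies[OF assms q this] x
    show "is_pullback C (N h) k (Q f \<cdot> x) (\<eta> Y)" by blast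
  qed
  assume v: "v \<in> hom C W (src C (R f)) \<and> R f \<cdot> v = h \<and> \<eta> Y \<cdot> k = Q f \<cdot> v \<cdot> N h"
    and v': "v' \<in> hom C W (src C (R f)) \<and> R f \<cdot> v' = h \<and> \<eta> Y \<cdot> k = Q f \<cdot> v' \<cdot> N h"
  have "Q f \<cdot> v = Q f \<cdot> v'"
    by (rule classify_unique[OF N_M[OF h] s(3) k cl[OF v] cl[OF v']])
  then show "v = v'" using pullback_jointly_monic[OF r(1,2), of v W v'] v v' by simp
qed

text \<open>\<open>f\<close> and \<open>\<eta> Y\<close> are the projections of the cartesian
  naturality square, hence jointly monic.\<close>

lemma eta_cancel:
  assumes f: "f \<in> hom C Y L" and k: "k \<in> hom C X Y" "k' \<in> hom C X Y"
    and eq: "f \<cdot> k = f \<cdot> k'" "\<eta> Y \<cdot> k = \<eta> Y \<cdot> k'"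
  shows "k = k'"
  using pullback_jointly_monic[OF pullback_swap[OF eta_cartesian[OF f]] f k eq] .

text \<open>Evaluates the transpose of \<open>v\<close>, namely its pullback along \<open>m\<close>
  followed by the counit. Testing after \<open>\<eta> Y\<close> brings in the projection equations
  of both and leaves the expression occurring in \<open>transpose_ex1\<close>.\<close>

lemma counit_transpose:
  assumes f: "f \<in> hom C Y L" and h: "h \<in> hom C W G"
    and v: "v \<in> hom C W (src C (R f))" "R f \<cdot> v = h"
  obtains z where "amap (pb C \<chi> m) (h, v, R f) = (S h, z, S (R f))"
    "z \<in> hom C (src C (S h)) (src C (S (R f)))" "S (R f) \<cdot> z = S h"
    "\<eta> Y \<cdot> (counit f \<cdot> z) = Q f \<cdot> v \<cdot> N h"
proof -
  note r = R_pullback[OF f] and s = S_pullback[OF h] and c = counit[OF f]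
  note s' = S_pullback[OF r(2)]
  obtain z where z: "amap (pb C \<chi> m) (h, v, R f) = (S h, z, S (R f))"
    "z \<in> hom C (src C (S h)) (src C (S (R f)))" "S (R f) \<cdot> z = S h" "N (R f) \<cdot> z = v \<cdot> N h"
    using pb_amap[OF m_hom h r(2) v] unfolding S_def N_def .
  have "\<eta> Y \<cdot> (counit f \<cdot> z) = Q f \<cdot> N (R f) \<cdot> z"
    using comp_assoc[OF z(2) c(1) eta_hom[OF obj_of_hom(1)[OF f]]] c(3) by simp
  also have "\<dots> = Q f \<cdot> v \<cdot> N h"
    using comp_assoc[OF z(2) s'(3) r(3)] z(4) comp_assoc[OF s(3) v(1) r(3)] by simp
  finally show thesis using that z by blast
qed

section \<open>Functoriality of \<open>fpbc\<close>, and naturality and universality of the counit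
  in the slices\<close>

lemma fpbc_amap:
  assumes f: "f \<in> hom C Y L" and g: "g \<in> hom C Z L" and k: "k \<in> hom C Y Z" "g \<cdot> k = f"
  obtains v where "amap (fpbc C \<chi> T \<eta> m) (f, k, g) = (R f, v, R g)"
    "v \<in> hom C (src C (R f)) (src C (R g))" "R g \<cdot> v = R f" "Q g \<cdot> v = amap T k \<cdot> Q f"
proof -
  note Th = functor_hom[OF T_functor]
  have "amap T g \<cdot> amap T k = amap T f" using functor_comp[OF T_functor k(1) g] k(2) by simp
  from pb_amap[OF bar(1) Th[OF f] Th[OF g] Th[OF k(1)] this] that show thesis
    unfolding R_def[symmetric] Q_def[symmetric]
    by (auto simp: fpbc_def comp_functor_simps slice_map_def bar_def)
qed

lemma fpbc_functor: "is_functor (slice C L) (slice C G) (fpbc C \<chi> T \<eta> m)"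
  unfolding fpbc_def
  using comp_functor_is_functor[OF slice_map_functor[OF T_functor] pb_functor[OF bar(1)]]
  by (simp add: bar_def)

definition E where "E f = (S (R f), counit f, f)"

lemma E_arr:
  assumes f: "f \<in> hom C Y L"
  shows "E f \<in> hom (slice C L) (S (R f)) f"
  using counit[OF f] S_pullback(2)[OF R_pullback(2)[OF f]] f homD[OF f]
  by (simp add: E_def slice_hom)

lemma pb_fpbc_omap: "omap (pb C \<chi> m \<circ>\<^sub>F fpbc C \<chi> T \<eta> m) f = S (R f)"
  by (simp add: comp_functor_simps fpbc_omap pb_omap S_def)

lemma counit_natural:
  "natural_transformation (slice C L) (slice C L) (pb C \<chi> m \<circ>\<^sub>F fpbc C \<chi> T \<eta> m) id_functor E"
proof (rule natural_transformationI)
  show "is_functor (slice C L) (slice C L) (pb C \<chi> m \<circ>\<^sub>F fpbc C \<chi> T \<eta> m)"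
    by (rule comp_functor_is_functor[OF fpbc_functor pb_functor[OF m_hom]])
  show "is_functor (slice C L) (slice C L) id_functor"
    by (rule id_functor_is_functor[OF slice_category])
next
  fix f assume "f \<in> obj (slice C L)"
  then show "E f \<in> hom (slice C L) (omap (pb C \<chi> m \<circ>\<^sub>F fpbc C \<chi> T \<eta> m) f) (omap id_functor f)"
    using E_arr[of f "src C f"] by (simp add: slice_simps pb_fpbc_omap id_functor_simps)
next
  fix t f g assume "t \<in> hom (slice C L) f g"
  then obtain k where t: "t = (f, k, g)" and f: "f \<in> hom C (src C f) L" and g: "g \<in> hom C (src C g) L"
    and k: "k \<in> hom C (src C f) (src C g)" "g \<cdot> k = f" by (auto simp: slice_hom)
  note rf = R_pullback[OF f] and rg = R_pullback[OF g] and cf = counit[OF f] and cg = counit[OF g]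
  note sf = S_pullback[OF rf(2)]
  note Tk = functor_hom[OF T_functor k(1)]
  have eta: "\<eta> (src C f) \<in> hom C (src C f) (omap T (src C f))"
    "\<eta> (src C g) \<in> hom C (src C g) (omap T (src C g))"
    using eta_hom obj_of_hom[OF k(1)] by auto
  obtain v where v: "amap (fpbc C \<chi> T \<eta> m) (f, k, g) = (R f, v, R g)"
    "v \<in> hom C (src C (R f)) (src C (R g))" "R g \<cdot> v = R f" "Q g \<cdot> v = amap T k \<cdot> Q f"
    using fpbc_amap[OF f g k] .
  obtain z where z: "amap (pb C \<chi> m) (R f, v, R g) = (S (R f), z, S (R g))"
    "z \<in> hom C (src C (S (R f))) (src C (S (R g)))" "S (R g) \<cdot> z = S (R f)"
    "\<eta> (src C g) \<cdot> (counit g \<cdot> z) = Q g \<cdot> v \<cdot> N (R f)"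
    using counit_transpose[OF g rf(2) v(2,3)] .
  \<comment> \<open>Naturality in the slice comes down to this equation in \<open>C\<close>. After
    \<open>g\<close> both sides are \<open>S (R f)\<close>; after \<open>\<eta>\<close> they are
    compared by moving \<open>k\<close> across to \<open>amap T k\<close>.\<close>
  have "k \<cdot> counit f = counit g \<cdot> z"
  proof (rule eta_cancel[OF g comp_hom[OF cf(1) k(1)] comp_hom[OF z(2) cg(1)]])
    show "g \<cdot> (k \<cdot> counit f) = g \<cdot> (counit g \<cdot> z)"
      using comp_assoc[OF cf(1) k(1) g] comp_assoc[OF z(2) cg(1) g] k(2) cf(2) cg(2) z(3) by simp
    have "\<eta> (src C g) \<cdot> (k \<cdot> counit f) = amap T k \<cdot> (\<eta> (src C f) \<cdot> counit f)"
      using comp_assoc[OF cf(1) k(1) eta(2)] comp_assoc[OF cf(1) eta(1) Tk] eta_natural[OF k(1)] by simp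
    also have "\<dots> = Q g \<cdot> v \<cdot> N (R f)"
      using cf(3) comp_assoc[OF sf(3) rf(3) Tk] v(4) by simp
    finally show "\<eta> (src C g) \<cdot> (k \<cdot> counit f) = \<eta> (src C g) \<cdot> (counit g \<cdot> z)" using z(4) by simp
  qed
  then show "amap id_functor t \<cdot>\<^bsub>slice C L\<^esub> E f =
      E g \<cdot>\<^bsub>slice C L\<^esub> amap (pb C \<chi> m \<circ>\<^sub>F fpbc C \<chi> T \<eta> m) t"
    by (simp add: t id_functor_simps comp_functor_simps v(1) z(1) E_def slice_simps)
qed

lemma counit_natural_isomorphism:
  "natural_isomorphism (slice C L) (slice C L) (pb C \<chi> m \<circ>\<^sub>F fpbc C \<chi> T \<eta> m) id_functor E"
  unfolding natural_isomorphism_def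
proof (intro conjI ballI counit_natural)
  fix f assume "f \<in> obj (slice C L)"
  then have f: "f \<in> hom C (src C f) L" by (simp add: slice_simps)
  show "is_iso (slice C L) (E f)"
    using slice_is_iso[OF _ counit_iso[OF f]] homD(1)[OF E_arr[OF f]] by (simp add: E_def)
qed

text \<open>A slice arrow from \<open>h\<close> to \<open>R f\<close> is determined by its middle
  component \<open>v\<close>, and for \<open>v\<close> the factorization condition is the equation
  solved uniquely in \<open>transpose_ex1\<close>.\<close>

lemma counit_universal:
  assumes h: "h \<in> obj (slice C G)" and f: "f \<in> obj (slice C L)"
    and g: "g \<in> hom (slice C L) (omap (pb C \<chi> m) h) f"
  shows "\<exists>!t. t \<in> hom (slice C G) h (omap (fpbc C \<chi> T \<eta> m) f) \<and>
    E f \<cdot>\<^bsub>slice C L\<^esub> amap (pb C \<chi> m) t = g"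
proof -
  from h f have hh: "h \<in> hom C (src C h) G" and fh: "f \<in> hom C (src C f) L"
    by (simp_all add: slice_simps)
  from g obtain k where k: "g = (S h, k, f)" "k \<in> hom C (src C (S h)) (src C f)" "f \<cdot> k = S h"
    by (auto simp: slice_hom pb_omap S_def)
  \<comment> \<open>Both \<open>counit f \<cdot> z\<close> and \<open>k\<close> become
    \<open>S h\<close> after \<open>f\<close>, so by \<open>eta_cancel\<close> they are equal
    exactly when they agree after \<open>\<eta>\<close>; \<open>counit_transpose\<close> evaluates
    that condition.\<close>
  have iff: "E f \<cdot>\<^bsub>slice C L\<^esub> amap (pb C \<chi> m) (h, v, R f) = g \<longleftrightarrow>
      \<eta> (src C f) \<cdot> k = Q f \<cdot> v \<cdot> N h"
    if v: "v \<in> hom C (src C h) (src C (R f))" "R f \<cdot> v = h" for v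
  proof -
    obtain z where z: "amap (pb C \<chi> m) (h, v, R f) = (S h, z, S (R f))"
      "z \<in> hom C (src C (S h)) (src C (S (R f)))" "S (R f) \<cdot> z = S h"
      "\<eta> (src C f) \<cdot> (counit f \<cdot> z) = Q f \<cdot> v \<cdot> N h"
      using counit_transpose[OF fh hh v] .
    note c = counit[OF fh]
    have "f \<cdot> (counit f \<cdot> z) = f \<cdot> k" using comp_assoc[OF z(2) c(1) fh] c(2) z(3) k(3) by simp
    then have "counit f \<cdot> z = k \<longleftrightarrow> \<eta> (src C f) \<cdot> (counit f \<cdot> z) = \<eta> (src C f) \<cdot> k"
      using eta_cancel[OF fh comp_hom[OF z(2) c(1)] k(2)] by auto
    then show ?thesis using z(4) by (auto simp: z(1) k(1) E_def slice_simps)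
  qed
  obtain v where v: "v \<in> hom C (src C h) (src C (R f))" "R f \<cdot> v = h"
      "\<eta> (src C f) \<cdot> k = Q f \<cdot> v \<cdot> N h"
    and uniq: "\<And>v'. v' \<in> hom C (src C h) (src C (R f)) \<Longrightarrow> R f \<cdot> v' = h \<Longrightarrow>
      \<eta> (src C f) \<cdot> k = Q f \<cdot> v' \<cdot> N h \<Longrightarrow> v' = v"
    using ex1E[OF transpose_ex1[OF fh hh k(2,3)]] by (metis (no_types, lifting))
  show ?thesis
  proof (rule ex1I[of _ "(h, v, R f)"])
    show "(h, v, R f) \<in> hom (slice C G) h (omap (fpbc C \<chi> T \<eta> m) f) \<and>
        E f \<cdot>\<^bsub>slice C L\<^esub> amap (pb C \<chi> m) (h, v, R f) = g"
      using v iff[OF v(1,2)] hh R_pullback(2)[OF fh] by (simp add: slice_hom fpbc_omap)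
  next
    fix t assume t: "t \<in> hom (slice C G) h (omap (fpbc C \<chi> T \<eta> m) f) \<and>
        E f \<cdot>\<^bsub>slice C L\<^esub> amap (pb C \<chi> m) t = g"
    then obtain v' where v': "t = (h, v', R f)" "v' \<in> hom C (src C h) (src C (R f))" "R f \<cdot> v' = h"
      by (auto simp: slice_hom fpbc_omap)
    then show "t = (h, v, R f)" using uniq[OF v'(2,3)] iff[OF v'(2,3)] t by simp
  qed
qed

end

theorem theorem5:
  fixes C :: "('o, 'a) precategory"
    and M :: "'a set"
    and T :: "('o, 'a, 'o, 'a) prefunctor"
    and \<eta> :: "'o \<Rightarrow> 'a"
    and \<chi> :: "'a \<Rightarrow> 'a \<Rightarrow> 'a \<times> 'a"
    and L G :: 'o
    and m :: 'a
  assumes "is_category C"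
    and "has_pullbacks C"
    and "pullback_choice C \<chi>"
    and "stable_system_of_monos C M"
    and "partial_map_classifier C M T \<eta>"
    and "m \<in> M"
    and "m \<in> hom C L G"
  shows "\<exists>u e.
    adjunction (slice C G) (slice C L) (pb C \<chi> m) (fpbc C \<chi> T \<eta> m) u e \<and>
    natural_isomorphism (slice C L) (slice C L)
      (pb C \<chi> m \<circ>\<^sub>F fpbc C \<chi> T \<eta> m) id_functor e"
proof -
  interpret fpbc_setting C \<chi> M T \<eta> L G m
    using assms by unfold_locales
  \<comment> \<open>The counit is fixed to be \<open>E\<close>, so that its invertibility applies to
    this very adjunction; only the unit is left existential.\<close>
  obtain u where "adjunction (slice C G) (slice C L) (pb C \<chi> m) (fpbc C \<chi> T \<eta> m) u E"
    using adjunction_of_universal_counit[OF pb_functor[OF m_hom] fpbc_functor counit_natural]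
      counit_universal by blast
  then show ?thesis using counit_natural_isomorphism by blast
qed

end
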